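(* Let $X$ be a real-valued random variable. For any integer $n\ge 1$, if $\mathsf{E}[|X|^n]<\infty$, then the $n$-th cumulant $\kappa_n(X)$ satisfies $$|\kappa_n(X)|\le C^{\mathrm{raw}}_n\,\mathsf{E}[|X|^n],\qquad C^{\mathrm{raw}}_n:=\sum_{\pi\in\mathcal{P}(n)}(|\pi|-1)!.$$ For $n\ge 2$, the coefficient $C^{\mathrm{raw}}_n$ is exactly $2\operatorname{Bell}(n-1)$.
   Context: $\mathcal{P}(n)$ is the set of all set partitions of $\{1,\dots,n\}$ into nonempty blocks, and $|\pi|$ is the number of blocks of $\pi$. For a random variable $X$ with $\mathsf{E}[|X|^n]<\infty$, write $m_k=\mathsf{E}[X^k]$ for $1\le k\le n$; the $n$-th cumulant is $$\kappa_n(X)=\sum_{\pi\in\mathcal{P}(n)}(-1)^{|\pi|-1}(|\pi|-1)!\prod_{B\in\pi}m_{|B|}.$$ The ordered Bell (Fubini) numbers are $\operatorname{Bell}(m)=\sum_{k=0}^{m} S(m,k)\,k!$ for $m\ge 0$, where $S(m,k)$ is the Stirling number of the second kind (number of partitions of an $m$-element set into $k$ nonempty blocks). *)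

theory Defs
  imports "HOL-Probability.Probability" "HOL-Combinatorics.Stirling"
begin

definition set_partitions :: "nat \<Rightarrow> nat set set set" where
  "set_partitions n = {P. partition_on {1..n} P}"

definition moment :: "'a measure \<Rightarrow> ('a \<Rightarrow> real) \<Rightarrow> nat \<Rightarrow> real" where
  "moment M X k = prob_space.expectation M (\<lambda>\<omega>. X \<omega> ^ k)"

text \<open>Only meaningful for \<open>n \<ge> 1\<close> and \<open>X\<close> with a finite \<open>n\<close>-th absolute moment: a moment that
  does not exist is \<open>0\<close> here, and \<open>card P - 1\<close> truncates if \<open>P\<close> is the empty partition.\<close>

definition cumulant :: "nat \<Rightarrow> 'a measure \<Rightarrow> ('a \<Rightarrow> real) \<Rightarrow> real" where
  "cumulant n M X =
     (\<Sum>P\<in>set_partitions n. (-1) ^ (card P - 1) * fact (card P - 1) * (\<Prod>B\<in>P. moment M X (card B)))"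

definition C_raw :: "nat \<Rightarrow> nat" where
  "C_raw n = (\<Sum>P\<in>set_partitions n. fact (card P - 1))"

definition ordered_Bell :: "nat \<Rightarrow> nat" where
  "ordered_Bell m = (\<Sum>k=0..m. Stirling m k * fact k)"

text \<open>The library defines \<^const>\<open>Stirling\<close> by its recurrence; it counts set partitions:\<close>

lemma partition_on_remove_point:
  assumes P: "partition_on (insert x A) P" and x: "x \<notin> A" and B: "B \<in> P" "x \<in> B"
  shows "partition_on A ((P - {B}) \<union> ({B - {x}} - {{}}))" "\<And>C. C \<in> P - {B} \<Longrightarrow> C \<inter> B = {}"
proof -
  have dj: "C \<inter> B = {}" if "C \<in> P - {B}" for C
    using P B that by (auto simp: partition_on_def disjoint_def)
  show "\<And>C. C \<in> P - {B} \<Longrightarrow> C \<inter> B = {}" by (rule dj)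
  have U: "\<Union>P = insert x A" using P by (simp add: partition_on_def)
  have "\<Union>((P - {B}) \<union> ({B - {x}} - {{}})) = A"
  proof -
    have "\<Union>(P - {B}) = \<Union>P - B"
    proof (intro equalityI subsetI)
      fix y assume "y \<in> \<Union>(P - {B})"
      then obtain C where "C \<in> P - {B}" "y \<in> C" by blast
      then show "y \<in> \<Union>P - B" using dj[of C] by blast
    qed blast
    then have "\<Union>(P - {B}) = insert x A - B" unfolding U .
    moreover have "\<Union>({B - {x}} - {{}}) = B - {x}" by auto
    moreover have "B \<subseteq> insert x A" using U B by blast
    ultimately show ?thesis using B(2) x unfolding Union_Un_distrib by auto
  qed
  moreover have "disjoint ((P - {B}) \<union> ({B - {x}} - {{}}))"
  proof -
    have "disjoint (P - {B})" using P by (auto simp: partition_on_def disjoint_def)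
    moreover have "disjnt C (B - {x})" if "C \<in> P - {B}" for C
      using dj[OF that] by (auto simp: disjnt_def)
    ultimately show ?thesis
      by (cases "B - {x} = {}") (simp_all add: insert_Diff_if pairwise_insert disjnt_sym)
  qed
  ultimately show "partition_on A ((P - {B}) \<union> ({B - {x}} - {{}}))"
    using P by (auto simp: partition_on_def)
qed

lemma card_partitions_eq_Stirling:
  assumes "finite A"
  shows "card {P. partition_on A P \<and> card P = k} = Stirling (card A) k"
  using assms
proof (induction A arbitrary: k rule: finite_induct)
  case empty
  have eq: "{P :: 'a set set. partition_on {} P \<and> card P = k} = (if k = 0 then {{}} else {})"
    by (auto simp: partition_on_empty)
  show ?case unfolding eq by (cases k) auto
next
  case (insert x A)
  define S where "S = (\<lambda>k. {P. partition_on A P \<and> card P = k})"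
  have fin_part: "finite P" if "partition_on B P" "finite B" for B :: "'a set" and P
    using finite_elements that by blast
  have finS: "finite (S k)" for k
    using insert.hyps(1) finitely_many_partition_on[of A] by (auto simp: S_def)
  show ?case
  proof (cases k)
    case 0
    have no: "{P. partition_on (insert x A) P \<and> card P = 0} = {}"
    proof -
      have "finite P \<and> P \<noteq> {}" if "partition_on (insert x A) P" for P
        using that fin_part[OF that] insert.hyps(1) by (auto simp: partition_on_def)
      then show ?thesis by (auto simp: card_eq_0_iff)
    qed
    show ?thesis unfolding 0 no using insert.hyps by simp
  next
    case (Suc j)
    define T1 where "T1 = insert {x} ` S j"
    define g where "g = (\<lambda>(P, B). insert (insert x B) (P - {B}))"
    define D where "D = (SIGMA P:S (Suc j). P)"
    have xP: "x \<notin> B" if "partition_on A P" "B \<in> P" for P B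
      using that insert.hyps by (auto simp: partition_on_def)
    have eq: "{P. partition_on (insert x A) P \<and> card P = Suc j} = T1 \<union> g ` D" (is "?L = _")
    proof (intro equalityI subsetI)
      fix P assume "P \<in> ?L"
      then have P: "partition_on (insert x A) P" "card P = Suc j" by auto
      have finP: "finite P" using fin_part P insert.hyps by auto
      from P obtain B where B: "B \<in> P" "x \<in> B" by (auto simp: partition_on_def)
      note r = partition_on_remove_point[OF P(1) insert.hyps(2) B]
      show "P \<in> T1 \<union> g ` D"
      proof (cases "B = {x}")
        case True
        then have "P - {B} \<in> S j" using r(1) P finP B by (simp add: S_def)
        moreover have "P = insert {x} (P - {B})" using B True by auto
        ultimately show ?thesis unfolding T1_def by blast
      next
        case False
        let ?Q = "insert (B - {x}) (P - {B})"
        have ne: "B - {x} \<noteq> {}" using False B by auto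
        have nin: "B - {x} \<notin> P - {B}" using r(2) ne by blast
        have "partition_on A ?Q" using r(1) ne by simp
        moreover have "card ?Q = Suc j" using nin P finP B by simp
        ultimately have "(?Q, B - {x}) \<in> D" by (simp add: D_def S_def)
        moreover have "g (?Q, B - {x}) = P"
          using nin B by (auto simp: g_def insert_absorb)
        ultimately show ?thesis by (metis UnI2 imageI)
      qed
    next
      fix P assume "P \<in> T1 \<union> g ` D"
      then show "P \<in> ?L"
      proof
        assume "P \<in> T1"
        then obtain Q where Q: "P = insert {x} Q" "partition_on A Q" "card Q = j"
          by (auto simp: T1_def S_def)
        then have "{x} \<notin> Q" using xP by blast
        then show ?thesis using Q fin_part[of A Q] insert.hyps
          by (auto simp: partition_on_def disjoint_def)
      next
        assume "P \<in> g ` D"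
        then obtain Q B where Q: "P = insert (insert x B) (Q - {B})" "partition_on A Q" "card Q = Suc j" "B \<in> Q"
          by (auto simp: g_def D_def S_def)
        have "insert x B \<notin> Q" using xP Q by blast
        moreover have "finite Q" using fin_part Q insert.hyps by blast
        ultimately have "card P = Suc j" using Q by simp
        moreover have "\<Union>P = insert x A" using Q by (auto simp: partition_on_def)
        moreover have "disjoint P"
        proof -
          have "disjnt C (insert x B)" if "C \<in> Q - {B}" for C
            using Q(2,4) xP[OF Q(2)] that by (auto simp: partition_on_def disjoint_def disjnt_def)
          moreover have "disjoint (Q - {B})"
            using Q(2) by (auto simp: partition_on_def disjoint_def)
          ultimately show ?thesis
            unfolding Q(1) by (auto simp: pairwise_insert disjnt_sym)
        qed
        moreover have "{} \<notin> P" using Q by (auto simp: partition_on_def)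
        ultimately show ?thesis by (simp add: partition_on_def)
      qed
    qed
    have inj1: "inj_on (insert {x}) (S j)"
    proof (rule inj_onI)
      fix P Q assume PQ: "P \<in> S j" "Q \<in> S j" and e: "insert {x} P = insert {x} Q"
      have "{x} \<notin> P" "{x} \<notin> Q" using PQ xP by (auto simp: S_def)
      then show "P = Q" using e by (simp add: insert_ident)
    qed
    have inj2: "inj_on g D"
    proof (rule inj_onI)
      fix p q assume pq: "p \<in> D" "q \<in> D" and e: "g p = g q"
      obtain P B Q C where [simp]: "p = (P, B)" "q = (Q, C)" by (cases p, cases q)
      have PQ: "partition_on A P" "partition_on A Q" "B \<in> P" "C \<in> Q"
        using pq by (auto simp: D_def S_def)
      have xx: "x \<notin> B" "x \<notin> C" and n: "insert x E \<notin> P" "insert x E \<notin> Q" for E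
        using xP PQ by blast+
      have e': "insert (insert x B) (P - {B}) = insert (insert x C) (Q - {C})"
        using e by (simp add: g_def)
      have "insert x B \<in> insert (insert x C) (Q - {C})" unfolding e'[symmetric] by simp
      then have "insert x B = insert x C" using n by simp
      then have BC: "B = C" using xx by (simp add: insert_ident)
      have "P - {B} = Q - {C}"
        using e' n unfolding BC by (simp add: insert_ident)
      then have "insert B (P - {B}) = insert C (Q - {C})" using BC by simp
      then show "p = q" using BC PQ by (simp add: insert_absorb)
    qed
    have disj: "T1 \<inter> g ` D = {}"
    proof -
      have False if "Q \<in> S j" "(R, B) \<in> D" "insert {x} Q = g (R, B)" for Q R B
      proof -
        have *: "partition_on A Q" "partition_on A R" "B \<in> R"
          using that by (auto simp: S_def D_def)
        have "{x} = insert x B"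
          using that(3) xP[OF *(2)] unfolding g_def by auto
        then have "B = {}" using xP[OF *(2,3)] by auto
        then show False using * by (auto simp: partition_on_def)
      qed
      then show ?thesis by (fastforce simp: T1_def)
    qed
    have finD: "finite D" unfolding D_def using finS fin_part insert.hyps(1)
      by (intro finite_SigmaI) (auto simp: S_def)
    have "card (T1 \<union> g ` D) = card (S j) + card D"
      using disj finS finD inj1 inj2 by (simp add: card_Un_disjoint card_image T1_def)
    also have "card D = (\<Sum>P\<in>S (Suc j). card P)"
      unfolding D_def using finS fin_part insert.hyps(1) by (intro card_SigmaI) (auto simp: S_def)
    also have "\<dots> = card (S (Suc j)) * Suc j" by (simp add: S_def)
    finally show ?thesis
      using Suc eq insert by (simp add: S_def algebra_simps)
  qed
qed

end

theory Submission
  imports Defs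
begin

text \<open>
  \<^bold>\<open>The bound.\<close> By the triangle inequality it suffices that
  \<open>\<bar>\<Prod>B\<in>P. m\<^bsub>card B\<^esub>\<bar> \<le> E \<bar>X\<bar> ^ n\<close> for each partition \<open>P\<close>, since the absolute values of the
  coefficients add up to \<^const>\<open>C_raw\<close>. Put \<open>A = E \<bar>X\<bar> ^ n\<close>. Lyapunov's inequality says
  \<open>\<bar>m\<^sub>k\<bar> \<le> A powr (k / n)\<close>, and the exponents \<open>card B / n\<close> of the blocks add up to \<open>1\<close>.
  The proof keeps all exponents integral and treats \<open>A = 0\<close> together with \<open>A > 0\<close>: for each
  \<open>t > 0\<close> with \<open>A \<le> t ^ n\<close> one has \<open>\<bar>m\<^sub>k\<bar> \<le> t ^ k\<close> (lemma \<open>abs_moment_le_power\<close>), whence the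
  product is at most \<open>t ^ n\<close>, and \<open>t ^ n\<close> can be any real number above \<open>A\<close>.

  \<^bold>\<open>The constant.\<close> Grouping partitions by their number of blocks gives
  \<open>C_raw n = (\<Sum>k=1..n. S(n, k) * (k - 1)!)\<close>. With \<open>S(n, k) = k * S(n - 1, k) + S(n - 1, k - 1)\<close>
  each summand becomes \<open>S(n - 1, k) * k! + S(n - 1, k - 1) * (k - 1)!\<close>, that is, two consecutive
  terms of the ordered Bell sum for \<open>n - 1\<close>; so that sum is obtained twice.
\<close>

section \<open>Bounding products of moments\<close>

text \<open>This is the weighted inequality between arithmetic and geometric mean, applied to
  \<open>(\<bar>x\<bar> / t) ^ n\<close> and \<open>1\<close> with the weights \<open>k / n\<close> and \<open>1 - k / n\<close>. The right-hand side is affine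
  in \<open>\<bar>x\<bar> ^ n\<close>, so that an expectation can be taken.\<close>

lemma abs_power_le_affine_higher_power:
  fixes x t :: real
  assumes "t > 0" "1 \<le> k" "k \<le> n"
  shows "\<bar>x\<bar> ^ k \<le> t ^ k * (real k / real n * (\<bar>x\<bar> ^ n / t ^ n) + (1 - real k / real n))"
proof (cases "x = 0")
  case True
  then show ?thesis using assms by (auto simp: power_0_left)
next
  case False
  define u where "u = \<bar>x\<bar> / t"
  have u: "u > 0" using False assms by (simp add: u_def)
  have "(u ^ n) powr (real k / real n) * 1 powr (1 - real k / real n)
          \<le> real k / real n * u ^ n + (1 - real k / real n) * 1"
    by (rule Youngs_inequality_0) (use assms u in auto)
  moreover have "(u ^ n) powr (real k / real n) = u ^ k"
    using assms u by (simp add: powr_powr flip: powr_realpow)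
  ultimately have "u ^ k \<le> real k / real n * u ^ n + (1 - real k / real n)"
    by simp
  then have "t ^ k * u ^ k \<le> t ^ k * (real k / real n * u ^ n + (1 - real k / real n))"
    using assms by (intro mult_left_mono) auto
  moreover have "t ^ k * u ^ k = \<bar>x\<bar> ^ k"
    using assms by (simp add: u_def power_divide)
  ultimately show ?thesis by (simp add: u_def power_divide)
qed

text \<open>Lyapunov's inequality without roots: taking \<open>t\<close> as the \<open>n\<close>-th root of \<open>E \<bar>X\<bar> ^ n\<close> gives
  the usual form, but here \<open>t\<close> stays positive even if \<open>X\<close> vanishes almost everywhere.\<close>

lemma abs_moment_le_power:
  assumes "prob_space M" and X: "X \<in> borel_measurable M"
    and int: "integrable M (\<lambda>\<omega>. \<bar>X \<omega>\<bar> ^ n)"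
    and t: "t > 0" "prob_space.expectation M (\<lambda>\<omega>. \<bar>X \<omega>\<bar> ^ n) \<le> t ^ n"
    and k: "1 \<le> k" "k \<le> n"
  shows "\<bar>moment M X k\<bar> \<le> t ^ k"
proof -
  interpret prob_space M by fact
  define g where
    "g = (\<lambda>\<omega>. t ^ k * (real k / real n * (\<bar>X \<omega>\<bar> ^ n / t ^ n) + (1 - real k / real n)))"
  have g: "integrable M g" unfolding g_def using int by auto
  have le: "\<bar>X \<omega> ^ k\<bar> \<le> g \<omega>" for \<omega>
    unfolding g_def power_abs by (rule abs_power_le_affine_higher_power[OF t(1) k])
  have "integrable M (\<lambda>\<omega>. X \<omega> ^ k)"
    by (rule Bochner_Integration.integrable_bound[OF g])
      (use X le in \<open>auto intro!: AE_I2 intro: order_trans[OF _ abs_ge_self]\<close>)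
  then have "expectation (\<lambda>\<omega>. \<bar>X \<omega> ^ k\<bar>) \<le> expectation g"
    using g le by (intro Bochner_Integration.integral_mono integrable_abs)
  then have "\<bar>moment M X k\<bar> \<le> expectation g"
    unfolding moment_def by (rule order_trans[OF integral_abs_bound])
  also have "\<dots> = t ^ k * (real k / real n * (expectation (\<lambda>\<omega>. \<bar>X \<omega>\<bar> ^ n) / t ^ n)
                         + (1 - real k / real n))"
    unfolding g_def using int by (simp add: prob_space)
  also have "\<dots> \<le> t ^ k * (real k / real n * 1 + (1 - real k / real n))"
    using t k by (intro mult_left_mono add_right_mono) (auto simp: divide_le_eq_1)
  finally show ?thesis by simp
qed

lemma abs_prod_moments_le:
  assumes "prob_space M" and "X \<in> borel_measurable M"
    and "integrable M (\<lambda>\<omega>. \<bar>X \<omega>\<bar> ^ n)" and n: "n \<ge> 1" and P: "P \<in> set_partitions n"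
  shows "\<bar>\<Prod>B\<in>P. moment M X (card B)\<bar> \<le> prob_space.expectation M (\<lambda>\<omega>. \<bar>X \<omega>\<bar> ^ n)"
proof (rule dense_ge)
  fix c assume c: "prob_space.expectation M (\<lambda>\<omega>. \<bar>X \<omega>\<bar> ^ n) < c"
  have part: "partition_on {1..n} P" using P by (simp add: set_partitions_def)
  have sub: "B \<subseteq> {1..n}" "B \<noteq> {}" if "B \<in> P" for B
    using part that by (auto simp: partition_on_def)
  have fin: "finite B" if "B \<in> P" for B
    using finite_subset[OF sub(1)[OF that]] by simp
  have "0 \<le> prob_space.expectation M (\<lambda>\<omega>. \<bar>X \<omega>\<bar> ^ n)" by simp
  then have "c > 0" using c by linarith
  define t where "t = root n c"
  have t: "t > 0" "t ^ n = c" using \<open>c > 0\<close> n by (auto simp: t_def real_root_pow_pos2)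
  have "\<bar>moment M X (card B)\<bar> \<le> t ^ card B" if "B \<in> P" for B
  proof (rule abs_moment_le_power[OF assms(1-3) t(1)])
    show "1 \<le> card B" using fin sub that by (simp add: Suc_le_eq card_gt_0_iff)
    show "card B \<le> n" using card_mono[OF _ sub(1)[OF that]] by simp
  qed (use c t in simp)
  then have "(\<Prod>B\<in>P. \<bar>moment M X (card B)\<bar>) \<le> (\<Prod>B\<in>P. t ^ card B)"
    by (intro prod_mono) auto
  also have "\<dots> = t ^ (\<Sum>B\<in>P. card B)" by (simp add: power_sum)
  also have "(\<Sum>B\<in>P. card B) = n" using product_partition[OF part fin] by simp
  finally show "\<bar>\<Prod>B\<in>P. moment M X (card B)\<bar> \<le> c" using t by (simp add: abs_prod)
qed

theorem abs_cumulant_le: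
  assumes "prob_space M" and "X \<in> borel_measurable M"
    and "integrable M (\<lambda>\<omega>. \<bar>X \<omega>\<bar> ^ n)" and "n \<ge> 1"
  shows "\<bar>cumulant n M X\<bar> \<le> real (C_raw n) * prob_space.expectation M (\<lambda>\<omega>. \<bar>X \<omega>\<bar> ^ n)"
proof -
  have "\<bar>cumulant n M X\<bar>
          \<le> (\<Sum>P\<in>set_partitions n. fact (card P - 1) * \<bar>\<Prod>B\<in>P. moment M X (card B)\<bar>)"
    unfolding cumulant_def by (rule order_trans[OF sum_abs]) (simp add: abs_mult)
  also have "\<dots> \<le> (\<Sum>P\<in>set_partitions n.
                    fact (card P - 1) * prob_space.expectation M (\<lambda>\<omega>. \<bar>X \<omega>\<bar> ^ n))"
    using abs_prod_moments_le[OF assms] by (intro sum_mono mult_left_mono) auto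
  also have "\<dots> = real (C_raw n) * prob_space.expectation M (\<lambda>\<omega>. \<bar>X \<omega>\<bar> ^ n)"
    by (simp add: C_raw_def sum_distrib_right)
  finally show ?thesis .
qed

section \<open>Evaluating the constant\<close>

lemma card_set_partition_bounds:
  assumes "P \<in> set_partitions n" "n \<ge> 1"
  shows "card P \<in> {1..n}"
proof -
  have part: "partition_on {1..n} P" using assms by (simp add: set_partitions_def)
  have finP: "finite P" using finite_elements[OF _ part] by simp
  have sub: "B \<subseteq> {1..n}" "B \<noteq> {}" if "B \<in> P" for B
    using part that by (auto simp: partition_on_def)
  have fin: "finite B" if "B \<in> P" for B
    using finite_subset[OF sub(1)[OF that]] by simp
  have "P \<noteq> {}" using part assms(2) by (auto simp: partition_on_def)
  moreover have "card P \<le> (\<Sum>B\<in>P. card B)"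
    using sum_mono[of P "\<lambda>_. 1" card] fin sub by (simp add: Suc_le_eq card_gt_0_iff)
  ultimately show ?thesis
    using finP product_partition[OF part fin] by (simp add: Suc_le_eq card_gt_0_iff)
qed

lemma C_raw_eq_sum_Stirling:
  assumes "n \<ge> 1"
  shows "C_raw n = (\<Sum>k=1..n. Stirling n k * fact (k - 1))"
proof -
  have fin: "finite (set_partitions n)"
    unfolding set_partitions_def by (simp add: finitely_many_partition_on)
  have "C_raw n = (\<Sum>k=1..n. \<Sum>P\<in>{P \<in> set_partitions n. card P = k}. fact (card P - 1))"
    unfolding C_raw_def
    by (rule sum.group[symmetric]) (use fin card_set_partition_bounds assms in auto)
  also have "\<dots> = (\<Sum>k=1..n. card {P \<in> set_partitions n. card P = k} * fact (k - 1))"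
    by (intro sum.cong) auto
  also have "\<dots> = (\<Sum>k=1..n. Stirling n k * fact (k - 1))"
    using card_partitions_eq_Stirling[of "{1..n}"] by (simp add: set_partitions_def)
  finally show ?thesis .
qed

lemma C_raw_eq_ordered_Bell:
  assumes "m \<ge> 1"
  shows "C_raw (Suc m) = 2 * ordered_Bell m"
proof -
  have "C_raw (Suc m) = (\<Sum>k=0..m. Stirling (Suc m) (Suc k) * fact k)"
    using C_raw_eq_sum_Stirling[of "Suc m"]
    by (simp add: sum.shift_bounds_cl_Suc_ivl del: Stirling.simps sum.cl_ivl_Suc)
  also have "\<dots> = (\<Sum>k=0..m. Stirling m (Suc k) * fact (Suc k)) + ordered_Bell m"
    by (simp add: ordered_Bell_def algebra_simps flip: sum.distrib)
  \<comment> \<open>The shifted sum loses the term at \<open>0\<close>, which vanishes since \<open>m > 0\<close>, and gains the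
     vanishing term at \<open>m + 1\<close>.\<close>
  also have "(\<Sum>k=0..m. Stirling m (Suc k) * fact (Suc k)) = ordered_Bell m"
  proof -
    have "Stirling m 0 = 0" using assms by (cases m) auto
    then have "ordered_Bell m = (\<Sum>k=0..Suc m. Stirling m k * fact k)"
      by (simp add: ordered_Bell_def)
    also have "\<dots> = (\<Sum>k=0..m. Stirling m (Suc k) * fact (Suc k))"
      using \<open>Stirling m 0 = 0\<close>
      by (simp add: sum.atLeast0_atMost_Suc_shift del: sum.cl_ivl_Suc fact_Suc)
    finally show ?thesis by simp
  qed
  finally show ?thesis by simp
qed

theorem theorem3p2:
  fixes M :: "'a measure" and X :: "'a \<Rightarrow> real"
  assumes "prob_space M" and "X \<in> borel_measurable M"
  shows "(\<forall>n\<ge>1. integrable M (\<lambda>\<omega>. \<bar>X \<omega>\<bar> ^ n) \<longrightarrow>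
            \<bar>cumulant n M X\<bar> \<le> real (C_raw n) * prob_space.expectation M (\<lambda>\<omega>. \<bar>X \<omega>\<bar> ^ n))
       \<and> (\<forall>n\<ge>2. C_raw n = 2 * ordered_Bell (n - 1))"
proof (intro conjI allI impI)
  fix n :: nat assume "n \<ge> 1" "integrable M (\<lambda>\<omega>. \<bar>X \<omega>\<bar> ^ n)"
  then show "\<bar>cumulant n M X\<bar> \<le> real (C_raw n) * prob_space.expectation M (\<lambda>\<omega>. \<bar>X \<omega>\<bar> ^ n)"
    using abs_cumulant_le assms by blast
next
  fix n :: nat assume "n \<ge> 2"
  then show "C_raw n = 2 * ordered_Bell (n - 1)"
    using C_raw_eq_ordered_Bell[of "n - 1"] by simp
qed

end
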